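(* For every $n\geq 0$, the poset $(\mathscr{D}_n,\leq)$ of Dyck paths of size $n$ with the dexter order is a meet-semilattice: any two elements have a greatest lower bound.
   Context: A Dyck path of size $n\geq 0$ is a word of length $2n$ in the letters $0,1$ with $n$ letters $1$ and $n$ letters $0$ such that every prefix contains at least as many $1$'s as $0$'s (the height after a prefix is its number of $1$'s minus its number of $0$'s). Let $\mathscr{D}_n$ be the set of Dyck paths of size $n$. A subpath of a Dyck path $w$ is a non-empty sequence $x$ of consecutive letters of $w$ that starts and ends at the same height and stays strictly above that height in between. A subpath $x$ is movable in $w$ if it is immediately preceded in $w$ by the letter $0$ and either $x$ ends at the last letter of $w$ or $x$ is immediately followed in $w$ by the letter $1$. For a movable subpath $x$, let $N=N(w,x)\geq 1$ be the number of consecutive letters $0$ just before $x$, so $w=a\,0^{N}\,x\,b$ where $a$ does not end with $0$; for $1\leq i\leq N$ let $M(w,x,i)=a\,0^{N-i}\,x\,0^{i}\,b\in\mathscr{D}_n$. Let $\Gamma_n$ be the directed graph on $\mathscr{D}_n$ with edges $w\to M(w,x,i)$ for all movable $x$ in $w$ and all $1\leq i\leq N(w,x)$. The dexter order is: $u\leq v$ if and only if there is a directed path (possibly of length $0$) from $u$ to $v$ in $\Gamma_n$. This is a partial order whose cover relations are exactly the edges of $\Gamma_n$. *)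

theory Defs
  imports "HOL-Algebra.Lattice" "HOL-Library.Sublist"
begin

text \<open>Words are lists over the letters \<open>0\<close> and \<open>1\<close>, written \<open>L0\<close> and \<open>L1\<close>.\<close>

datatype letter = L0 | L1

definition height :: "letter list \<Rightarrow> int" where
  "height u = int (count_list u L1) - int (count_list u L0)"

definition dyck_paths :: "nat \<Rightarrow> letter list set" where
  "dyck_paths n = {w. length w = 2 * n \<and> count_list w L1 = n \<and> count_list w L0 = n \<and>
     (\<forall>u. prefix u w \<longrightarrow> count_list u L0 \<le> count_list u L1)}"

text \<open>
  A subpath is an occurrence of a factor, not just a word.  It is given by the factorisation
  \<open>w = p @ x @ s\<close> of the path, so \<open>height p\<close> is the height at which the subpath \<open>x\<close> starts.
\<close>

definition subpath :: "letter list \<Rightarrow> letter list \<Rightarrow> letter list \<Rightarrow> letter list \<Rightarrow> bool" where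
  "subpath w p x s \<longleftrightarrow> w = p @ x @ s \<and> x \<noteq> [] \<and> height (p @ x) = height p \<and>
     (\<forall>u. strict_prefix u x \<and> u \<noteq> [] \<longrightarrow> height p < height (p @ u))"

definition movable :: "letter list \<Rightarrow> letter list \<Rightarrow> letter list \<Rightarrow> letter list \<Rightarrow> bool" where
  "movable w p x s \<longleftrightarrow> subpath w p x s \<and> p \<noteq> [] \<and> last p = L0 \<and> (s = [] \<or> hd s = L1)"

text \<open>
  The edges of the graph on \<open>dyck_paths n\<close>.  The condition on \<open>a\<close> makes \<open>N\<close> the number of
  consecutive letters \<open>0\<close> just before \<open>x\<close>.  That the target is again a Dyck path is not
  required here; it is proved in \<open>dexter_edge_closed\<close>.
\<close>

definition dexter_edge :: "nat \<Rightarrow> letter list \<Rightarrow> letter list \<Rightarrow> bool" where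
  "dexter_edge n w w' \<longleftrightarrow> w \<in> dyck_paths n \<and>
     (\<exists>a N x b i. w = a @ replicate N L0 @ x @ b \<and> (a = [] \<or> last a \<noteq> L0) \<and>
        movable w (a @ replicate N L0) x b \<and> 1 \<le> i \<and> i \<le> N \<and>
        w' = a @ replicate (N - i) L0 @ x @ replicate i L0 @ b)"

definition dexter_poset :: "nat \<Rightarrow> letter list gorder" where
  "dexter_poset n = \<lparr>carrier = dyck_paths n, eq = (=), le = (dexter_edge n)\<^sup>*\<^sup>*\<rparr>"

lemma height_simps [simp]:
  "height [] = 0"
  "height (u @ v) = height u + height v"
  "height (replicate k L0) = - int k"
  by (induction k) (auto simp: height_def)

lemma dyck_paths_iff:
  "w \<in> dyck_paths n \<longleftrightarrow>
     length w = 2 * n \<and> height w = 0 \<and> (\<forall>u. prefix u w \<longrightarrow> 0 \<le> height u)"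
proof -
  have "count_list w L0 + count_list w L1 = length w" for w
  proof (induction w)
    case (Cons c w)
    then show ?case by (cases c) auto
  qed simp
  from this[of w] show ?thesis
    by (auto simp: dyck_paths_def height_def)
qed

lemma prefix_replicateE:
  assumes "prefix u (replicate k c)"
  obtains j where "j \<le> k" "u = replicate j c"
proof -
  have "length u \<le> k"
    using prefix_length_le[OF assms] by simp
  moreover have "u = take (length u) (replicate k c)"
    using assms by (metis append_eq_conv_conj prefixE)
  ultimately show ?thesis using that[of "length u"] by (simp add: min_def)
qed

lemma dexter_edge_closed:
  assumes "dexter_edge n w w'"
  shows "w' \<in> dyck_paths n"
proof -
  obtain a N x b i where w: "w \<in> dyck_paths n" "w = a @ replicate N L0 @ x @ b"
    and m: "movable w (a @ replicate N L0) x b" and i: "i \<le> N"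
    and w': "w' = a @ replicate (N - i) L0 @ x @ replicate i L0 @ b"
    using assms unfolding dexter_edge_def by blast
  have hx: "height x = 0"
    using m by (simp add: movable_def subpath_def)
  have D: "length w = 2 * n" "height w = 0" "\<And>u. prefix u w \<Longrightarrow> 0 \<le> height u"
    using w by (auto simp: dyck_paths_iff)
  have base: "int N \<le> height a"
    using D(3)[of "a @ replicate N L0"] w(2) by simp
  have "0 \<le> height u" if u: "prefix u w'" for u
  proof -
    consider "prefix u a"
      | v where "u = a @ v" "prefix v (replicate (N - i) L0)"
      | v where "u = a @ replicate (N - i) L0 @ v" "prefix v x"
      | v where "u = a @ replicate (N - i) L0 @ x @ v" "prefix v (replicate i L0)"
      | v where "u = a @ replicate (N - i) L0 @ x @ replicate i L0 @ v" "prefix v b"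
      using u unfolding w' prefix_append by blast
    then show ?thesis
    proof cases
      case 1
      then show ?thesis using D(3)[of u] w(2) by (simp add: prefix_append)
    next
      case 2
      then show ?thesis using base i by (auto elim!: prefix_replicateE)
    next
      case 3
      then show ?thesis
        using D(3)[of "a @ replicate N L0 @ v"] w(2) i by (auto simp: prefix_append of_nat_diff)
    next
      case 4
      then show ?thesis using base i hx by (auto elim!: prefix_replicateE simp: of_nat_diff)
    next
      case 5
      then show ?thesis
        using D(3)[of "a @ replicate N L0 @ x @ v"] w(2) i by (auto simp: of_nat_diff)
    qed
  qed
  then show ?thesis
    using D(1,2) w(2) w' i by (auto simp: dyck_paths_iff of_nat_diff)
qed

end

(*
  Let h_k be the height of a path before its up-step number k, counted from 0, and let "close h i"
  be the first k > i with h_k <= h_i: the subpath starting at up-step i contains the up-steps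
  i, ..., close h i - 1.  The dexter order is described by these closing positions: u <= v iff
  close u <= close v pointwise and every strict nesting close u j < close u i (i < j) persists
  in v.  Each edge raises h by a constant on an interval [k, close h k) with h (close h k) = h k,
  which preserves both conditions; conversely, if u < v in this sense, some such raise ending in
  v starts above u.

  For the meet of u and v take a common lower bound d of maximal area.  If a common lower bound c
  were not below d, then d could be enlarged: raising d at a suitable position t = close d i
  (a Tamari step, in general not a dexter step) would yield another common lower bound.
*)

theory Submission
  imports Defs "HOL-Library.More_List"
begin

section \<open>Height sequences and closing positions\<close>

text \<open>The value \<open>0\<close> at and beyond \<open>n\<close> ensures that \<open>close\<close> below is a minimum of a nonempty set.\<close>

definition hpath :: "nat \<Rightarrow> (nat \<Rightarrow> int) \<Rightarrow> bool" where
  "hpath n h \<longleftrightarrow> h 0 = 0 \<and> (\<forall>k. 0 \<le> h k) \<and> (\<forall>k. h (Suc k) \<le> h k + 1) \<and> (\<forall>k\<ge>n. h k = 0)"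

definition close :: "(nat \<Rightarrow> int) \<Rightarrow> nat \<Rightarrow> nat" where
  "close h i = (LEAST k. i < k \<and> h k \<le> h i)"

lemma close_eqI:
  assumes "i < k" "h k \<le> h i" "\<And>l. i < l \<Longrightarrow> l < k \<Longrightarrow> h i < h l"
  shows "close h i = k"
  unfolding close_def
proof (rule Least_equality)
  fix y assume "i < y \<and> h y \<le> h i"
  then show "k \<le> y" using assms(3)[of y] by force
qed (use assms in auto)

lemma close_le: "i < k \<Longrightarrow> h k \<le> h i \<Longrightarrow> close h i \<le> k"
  unfolding close_def by (rule Least_le) simp

lemma less_below_close: "i < k \<Longrightarrow> k < close h i \<Longrightarrow> h i < h k"
  using close_le[of i k h] by force

context
  fixes n h
  assumes h: "hpath n h"
begin

lemma close_props: "i < close h i \<and> h (close h i) \<le> h i"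
proof -
  have "i < n + Suc i \<and> h (n + Suc i) \<le> h i"
    using h by (simp add: hpath_def)
  then show ?thesis unfolding close_def by (rule LeastI)
qed

lemma close_gt: "i < close h i"
  using close_props by blast

lemma height_close: "h (close h i) \<le> h i"
  using close_props by blast

lemma le_below_close: "i \<le> k \<Longrightarrow> k < close h i \<Longrightarrow> h i \<le> h k"
  using less_below_close[of i k h] by (cases "i = k") auto

lemma close_nest: "i \<le> j \<Longrightarrow> j < close h i \<Longrightarrow> close h j \<le> close h i"
  using le_below_close[of i j] height_close[of i] by (intro close_le) auto

lemma close_le_n: "i < n \<Longrightarrow> close h i \<le> n"
  using h by (intro close_le) (auto simp: hpath_def)

lemma close_ge_n: "n \<le> i \<Longrightarrow> close h i = Suc i"
  using h by (intro close_eqI) (auto simp: hpath_def)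

lemma hpath_le: "h i \<le> int i"
proof (induction i)
  case (Suc i)
  then show ?case using h unfolding hpath_def by (smt (verit) of_nat_Suc)
qed (use h in \<open>simp add: hpath_def\<close>)

end

text \<open>The height \<open>u i\<close> counts the \<open>j < i\<close> with
  \<open>i < close u j\<close>, so later closing means greater height. The induction compares
  \<open>i\<close> only with its parent, the last earlier position strictly below it.\<close>

lemma height_mono_close:
  assumes u: "hpath n u" and v: "hpath n v" and le: "\<And>i. close u i \<le> close v i"
  shows "u i \<le> v i"
proof (induction i rule: less_induct)
  case (less i)
  show ?case
  proof (cases "u i = 0")
    case True
    then show ?thesis using v by (simp add: hpath_def)
  next
    case False
    then have pos: "u 0 < u i" "0 < i"
      using u unfolding hpath_def by (metis order_le_less, metis gr0I)
    define J where "J = {j. j < i \<and> u j < u i}"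
    have fin: "finite J" and ne: "J \<noteq> {}"
      unfolding J_def using pos by auto
    define j where "j = Max J"
    have j: "j < i" "u j < u i" using Max_in[OF fin ne] by (auto simp: J_def j_def)
    have jmax: "u i \<le> u l" if "j < l" "l < i" for l
    proof (rule ccontr)
      assume "\<not> ?thesis"
      then have "l \<in> J" using that by (simp add: J_def)
      then show False using Max_ge[OF fin, of l] that(1) by (simp add: j_def)
    qed
    have "u i \<le> u (Suc j)"
      using jmax[of "Suc j"] j by (cases "Suc j = i") auto
    then have uj: "u i \<le> u j + 1"
      using u unfolding hpath_def by (meson order_trans)
    have "i < close u j"
    proof (rule ccontr)
      assume "\<not> i < close u j"
      then have "u i \<le> u (close u j)"
        using jmax[of "close u j"] close_gt[OF u, of j] by (cases "close u j = i") auto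
      then show False using height_close[OF u, of j] j by simp
    qed
    then have "v j < v i"
      using le[of j] j(1) by (intro less_below_close) auto
    then show ?thesis using less.IH[OF j(1)] uj by simp
  qed
qed

section \<open>The order on height sequences\<close>

definition dle :: "(nat \<Rightarrow> int) \<Rightarrow> (nat \<Rightarrow> int) \<Rightarrow> bool" where
  "dle u v \<longleftrightarrow> (\<forall>i. close u i \<le> close v i) \<and>
     (\<forall>i j. i < j \<longrightarrow> close u j < close u i \<longrightarrow> close v j < close v i)"

lemma dle_refl: "dle u u"
  by (simp add: dle_def)

lemma dle_trans: "dle u v \<Longrightarrow> dle v w \<Longrightarrow> dle u w"
  unfolding dle_def by (meson order_trans)

lemma dle_close: "dle u v \<Longrightarrow> close u i \<le> close v i"
  by (simp add: dle_def)

lemma dle_inversion: "dle u v \<Longrightarrow> i < j \<Longrightarrow> close u j < close u i \<Longrightarrow> close v j < close v i"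
  by (simp add: dle_def)

lemma dle_antisym:
  assumes "hpath n u" "hpath n v" "dle u v" "dle v u"
  shows "u = v"
  using height_mono_close[OF assms(1,2)] height_mono_close[OF assms(2,1)] assms(3,4)
  by (intro ext antisym) (auto simp: dle_def)

text \<open>If \<open>h (close h k) = h k\<close>, the interval carries a subpath and a positive
  admissible \<open>r\<close> gives a dexter edge; without this equality the raise is only a Tamari
  move. Both cases occur below.\<close>

definition raise :: "(nat \<Rightarrow> int) \<Rightarrow> nat \<Rightarrow> int \<Rightarrow> nat \<Rightarrow> int" where
  "raise h k r = (\<lambda>l. if k \<le> l \<and> l < close h k then h l + r else h l)"

text \<open>The uniform shift changes no closing position inside the interval, and a position before
  \<open>k\<close> that closes after \<open>k\<close> closes no earlier than
  \<open>close h k\<close>. This leaves those closing exactly at \<open>k\<close>: the ones below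
  the new height of \<open>k\<close> run on to \<open>close h k\<close>, whose height is at most
  \<open>h k\<close>, hence at most theirs.\<close>

lemma close_raise:
  assumes h: "hpath n h" and r: "0 \<le> r"
  shows "close (raise h k r) j = (if close h j = k \<and> h j < h k + r then close h k else close h j)"
proof -
  let ?e = "close h k"
  note ke = close_gt[OF h, of k] and jc = close_gt[OF h, of j]
  have ge: "h l \<le> raise h k r l" for l
    using r by (simp add: raise_def)
  consider "k \<le> j" "j < ?e" | "?e \<le> j" | "j < k" "close h j < k" | "j < k" "k < close h j"
    | "close h j = k" "h j < h k + r" | "close h j = k" "h k + r \<le> h j"
    by linarith
  then show ?thesis
  proof cases
    case 1
    then have "close h j \<le> ?e" by (rule close_nest[OF h])
    then have "close (raise h k r) j = close h j"
      using 1 jc height_close[OF h, of j] r less_below_close[of j _ h]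
      by (intro close_eqI) (auto simp: raise_def)
    then show ?thesis using 1 jc by auto
  next
    case 2
    then have "close (raise h k r) j = close h j"
      using jc height_close[OF h, of j] r less_below_close[of j _ h] ke
      by (intro close_eqI) (auto simp: raise_def)
    then show ?thesis using 2 jc ke by auto
  next
    case 3
    then have "close (raise h k r) j = close h j"
      using jc height_close[OF h, of j] less_below_close[of j _ h]
      by (intro close_eqI) (auto simp: raise_def)
    then show ?thesis using 3 by auto
  next
    case 4
    have "?e \<le> close h j" using 4 by (intro close_nest[OF h]) auto
    have "h j < raise h k r l" if "j < l" "l < close h j" for l
      using less_below_close[of j l h] that ge[of l] by simp
    then have "close (raise h k r) j = close h j"
      using 4 jc height_close[OF h, of j] \<open>?e \<le> close h j\<close>
      by (intro close_eqI) (auto simp: raise_def)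
    then show ?thesis using 4 by auto
  next
    case 5
    have "h ?e \<le> h j"
      using height_close[OF h, of k] height_close[OF h, of j] 5 by simp
    then have "close (raise h k r) j = ?e"
      using 5 jc ke less_below_close[of j _ h] le_below_close[OF h, of k]
      by (intro close_eqI) (force simp: raise_def)+
    then show ?thesis using 5 by auto
  next
    case 6
    then have "close (raise h k r) j = k"
      using jc ke less_below_close[of j _ h]
      by (intro close_eqI) (auto simp: raise_def)
    then show ?thesis using 6 by auto
  qed
qed

lemma hpath_raise:
  assumes h: "hpath n h" and k: "0 < k" "k < n" and r: "0 \<le> r" "h k + r \<le> h (k - 1) + 1"
  shows "hpath n (raise h k r)"
proof -
  have "close h k \<le> n" using close_le_n[OF h k(2)] .
  moreover have "raise h k r (Suc l) \<le> raise h k r l + 1" for l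
  proof (cases "Suc l = k")
    case True
    then show ?thesis using r close_gt[OF h, of k] by (auto simp: raise_def)
  next
    case False
    have "h (Suc l) \<le> h l + 1" using h by (simp add: hpath_def)
    then show ?thesis using False r by (auto simp: raise_def)
  qed
  ultimately show ?thesis
    using h k r unfolding hpath_def by (auto simp: raise_def)
qed

text \<open>If \<open>j\<close> closes at \<open>k\<close> and \<open>i < j\<close> closes later,
  then \<open>i\<close> is strictly lower than \<open>k\<close>. As the end of the interval has
  height \<open>h k\<close>, \<open>i\<close> cannot close there, so the nesting stays strict when
  \<open>j\<close> moves to \<open>close h k\<close>.\<close>

lemma dle_raise:
  assumes h: "hpath n h" and r: "0 \<le> r" and eq: "h (close h k) = h k"
  shows "dle h (raise h k r)"
proof -
  have "close h k < close h i" if "i < j" "close h j = k" "k < close h i" for i j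
  proof -
    have "i < k" using that close_gt[OF h, of j] by simp
    then have "h i < h k" using that by (intro less_below_close)
    then have "close h i \<noteq> close h k" using height_close[OF h, of i] eq by force
    moreover have "close h k \<le> close h i"
      using \<open>i < k\<close> that by (intro close_nest[OF h]) auto
    ultimately show ?thesis by simp
  qed
  then show ?thesis
    using close_gt[OF h, of k] unfolding dle_def close_raise[OF h r]
    by (auto intro: less_trans)
qed

text \<open>Serves twice: being bounded, it yields a maximal common lower bound, and reachability is
  proved by induction on it.\<close>

definition area :: "nat \<Rightarrow> (nat \<Rightarrow> int) \<Rightarrow> nat" where
  "area n h = nat (\<Sum>i<n. h i)"

lemma area_less:
  assumes "hpath n h" "\<And>i. h i \<le> g i" "h k < g k" "k < n"
  shows "area n h < area n g"
proof -
  have "0 \<le> sum h {..<n}"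
    using assms(1) by (auto simp: hpath_def intro: sum_nonneg)
  moreover have "sum h {..<n} < sum g {..<n}"
    using assms by (intro sum_strict_mono_ex1) auto
  ultimately show ?thesis by (simp add: area_def)
qed

lemma area_le:
  assumes "hpath n h"
  shows "area n h \<le> n * n"
proof -
  have "sum h {..<n} \<le> (\<Sum>i<n. int n)"
  proof (rule sum_mono)
    show "h i \<le> int n" if "i \<in> {..<n}" for i
      using hpath_le[OF assms, of i] that by simp
  qed
  then show ?thesis by (simp add: area_def nat_le_iff)
qed

section \<open>Greatest lower bounds\<close>

context
  fixes n :: nat and d :: "nat \<Rightarrow> int" and i :: nat
  assumes d: "hpath n d"
begin

text \<open>The new height \<open>d i + 1\<close> of \<open>close d i\<close> is the least at which
  \<open>i\<close> no longer closes there.\<close>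

abbreviation (input) lift :: "nat \<Rightarrow> int" where
  "lift \<equiv> raise d (close d i) (d i + 1 - d (close d i))"

lemma close_lift:
  "close lift j = (if close d j = close d i \<and> j \<le> i then close d (close d i) else close d j)"
proof -
  \<comment> \<open>Positions with a common closing position get strictly higher from left to right,
    so the bound on heights cuts this class at \<open>i\<close>.\<close>
  have "d j < d i + 1 \<longleftrightarrow> j \<le> i" if "close d j = close d i"
    using that less_below_close[of j i d] less_below_close[of i j d] close_gt[OF d, of i]
      close_gt[OF d, of j] by (cases j i rule: linorder_cases) auto
  then show ?thesis
    using height_close[OF d, of i] by (subst close_raise[OF d]) auto
qed

lemma hpath_lift:
  assumes "close d i < n"
  shows "hpath n lift" "area n d < area n lift"
proof -
  have "i \<le> close d i - 1" "close d i - 1 < close d i" using close_gt[OF d, of i] by auto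
  then have "d i \<le> d (close d i - 1)" by (rule le_below_close[OF d])
  then show "hpath n lift"
    using assms close_gt[OF d, of i] height_close[OF d, of i] by (intro hpath_raise[OF d]) auto
  show "area n d < area n lift"
    using assms close_gt[OF d] height_close[OF d, of i]
    by (intro area_less[OF d, where k = "close d i"]) (auto simp: raise_def)
qed

text \<open>New strict nestings arise only inside subpaths starting at some \<open>p \<le> i\<close>
  that closed at \<open>close d i\<close>. For later members of the same class they are granted by
  \<open>cut\<close>; for positions in the lifted interval they follow from nestings inside that
  interval, which \<open>u\<close> inherits.\<close>

lemma lift_dle:
  assumes u: "hpath n u" and du: "dle d u" and lt: "close d i < close u i"
    and cut: "\<And>q. i < q \<Longrightarrow> close d q = close d i \<Longrightarrow> close u q < close u i"
  shows "dle lift u"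
proof -
  let ?t = "close d i"
  \<comment> \<open>In \<open>u\<close> the subpath at \<open>p\<close> contains \<open>i\<close>,
    whose own subpath reaches beyond \<open>?t\<close>; hence it contains the subpath at
    \<open>?t\<close> as well.\<close>
  have up: "close u i \<le> close u p" "close u ?t \<le> close u p" if "close d p = ?t" "p \<le> i" for p
  proof -
    have "?t \<le> close u p" using dle_close[OF du, of p] that by simp
    then show 1: "close u i \<le> close u p"
      using that close_gt[OF d, of i] by (intro close_nest[OF u]) auto
    show "close u ?t \<le> close u p"
      using 1 lt that close_gt[OF d, of i] by (intro close_nest[OF u]) auto
  qed
  have "close lift j \<le> close u j" for j
    unfolding close_lift using up(2)[of j] dle_close[OF du, of j] dle_close[OF du, of ?t] by auto
  moreover have "close u q < close u p" if pq: "p < q" "close lift q < close lift p" for p q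
  proof (cases "close d p = ?t \<and> p \<le> i")
    case False
    then have "close d q < close d p"
      using pq close_gt[OF d, of ?t] by (auto simp: close_lift split: if_splits)
    then show ?thesis using dle_inversion[OF du pq(1)] by simp
  next
    case True
    then have q: "close d q < close d ?t" "\<not> (close d q = ?t \<and> q \<le> i)"
      using pq(2) by (auto simp: close_lift split: if_splits)
    consider "close d q < ?t" | "close d q = ?t" | "?t < close d q" by linarith
    then show ?thesis
    proof cases
      case 1
      then show ?thesis using dle_inversion[OF du pq(1)] True by simp
    next
      case 2
      then have "close u q < close u i" using q(2) by (intro cut) auto
      then show ?thesis using up(1)[of p] True by simp
    next
      case 3
      have "\<not> q < ?t" using close_nest[OF d, of p q] 3 True pq(1) by auto
      moreover have "q \<noteq> ?t" using q(1) by auto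
      ultimately have "close u q < close u ?t" using q(1) by (intro dle_inversion[OF du]) auto
      then show ?thesis using up(2)[of p] True by simp
    qed
  qed
  ultimately show ?thesis by (simp add: dle_def)
qed

end

lemma dle_meet_exists:
  assumes u: "hpath n u" and v: "hpath n v"
  obtains d where "hpath n d" "dle d u" "dle d v"
    "\<And>c. hpath n c \<Longrightarrow> dle c u \<Longrightarrow> dle c v \<Longrightarrow> dle c d"
proof -
  define L where "L h \<longleftrightarrow> hpath n h \<and> dle h u \<and> dle h v" for h
  have zero: "close (\<lambda>_. 0) i = Suc i" for i
    by (intro close_eqI) auto
  \<comment> \<open>The zero sequence belongs to the path alternating 1 and 0: every position closes
    at once and nothing is strictly nested, so it lies below everything.\<close>
  have "L (\<lambda>_. 0)"
    using close_gt[OF u] close_gt[OF v] by (auto simp: L_def hpath_def dle_def zero Suc_le_eq)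
  then obtain d where d: "L d" "\<And>c. L c \<Longrightarrow> area n c \<le> area n d"
    using ex_has_greatest_nat[of L "\<lambda>_. 0" "area n" "Suc (n * n)"] area_le
    unfolding L_def by (metis le_imp_less_Suc)
  then have hd: "hpath n d" and du: "dle d u" and dv: "dle d v" by (auto simp: L_def)
  \<comment> \<open>At such an \<open>i\<close> the lift of \<open>d\<close> would be a common lower
    bound of larger area. Both halves of \<open>dle c d\<close> are refuted by exhibiting such a
    position.\<close>
  have max: False if "close d i < close u i" "close d i < close v i"
    "\<And>q. i < q \<Longrightarrow> close d q = close d i \<Longrightarrow> close u q < close u i \<and> close v q < close v i" for i
  proof -
    have "i < n" using that(1) close_ge_n[OF u, of i] close_ge_n[OF hd, of i] by force
    then have "close d i < n" using that(1) close_le_n[OF u, of i] by simp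
    then show False
      using hpath_lift[OF hd, of i] lift_dle[OF hd u du, of i] lift_dle[OF hd v dv, of i] that d(2)
      unfolding L_def by (meson leD)
  qed
  have "dle c d" if c: "hpath n c" "dle c u" "dle c v" for c
  proof -
    note cl = dle_close[OF c(2)] dle_close[OF c(3)]
    note inv = dle_inversion[OF c(2)] dle_inversion[OF c(3)]
    have le: "close c i \<le> close d i" for i
    proof (rule ccontr)
      assume i: "\<not> close c i \<le> close d i"
      \<comment> \<open>\<open>l\<close> is the last member of the class of \<open>i\<close> that
        \<open>c\<close> closes beyond \<open>close d i\<close>. Every later member closes strictly
        before it in \<open>c\<close>, a nesting that \<open>u\<close> and \<open>v\<close>
        inherit.\<close>
      define I where "I = {l. close d l = close d i \<and> close d i < close c l}"
      have "I \<subseteq> {..close d i}" using close_gt[OF hd] by (auto simp: I_def) (metis less_imp_le)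
      then have fin: "finite I" by (rule finite_subset) simp
      have ne: "I \<noteq> {}" using i by (auto simp: I_def)
      define l where "l = Max I"
      have l: "close d l = close d i" "close d i < close c l"
        using Max_in[OF fin ne] by (auto simp: I_def l_def)
      have "close c q < close c l" if "l < q" "close d q = close d l" for q
      proof -
        have "q \<notin> I" using Max_ge[OF fin, of q] that(1) by (auto simp: l_def)
        then show ?thesis using that l by (simp add: I_def)
      qed
      then show False
        using l cl[of l] inv[of l] by (intro max[of l]) (auto intro: less_le_trans)
    qed
    have "close d j < close d i" if ij: "i < j" "close c j < close c i" for i j
    proof (rule ccontr)
      assume neg: "\<not> close d j < close d i"
      have "j < close d i" using close_gt[OF c(1), of j] ij le[of i] by simp
      then have eq: "close d i = close d j" using close_nest[OF hd, of i j] ij(1) neg by simp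
      \<comment> \<open>\<open>l\<close> is the last member of the class of \<open>j\<close> in
        which \<open>c\<close> nests \<open>j\<close> strictly. Members \<open>q\<close> between
        \<open>l\<close> and \<open>j\<close> are strictly nested in \<open>l\<close> already in
        \<open>c\<close>; for \<open>q\<close> from \<open>j\<close> on, \<open>u\<close> and
        \<open>v\<close> nest \<open>q\<close> weakly in \<open>j\<close>, and \<open>j\<close>
        strictly in \<open>l\<close>.\<close>
      define I where "I = {l. l < j \<and> close d l = close d j \<and> close c j < close c l}"
      have fin: "finite I" and ne: "I \<noteq> {}" using ij eq by (auto simp: I_def)
      define l where "l = Max I"
      have l: "l < j" "close d l = close d j" "close c j < close c l"
        using Max_in[OF fin ne] by (auto simp: I_def l_def)
      note uv = inv[OF l(1,3)]
      have "close u q < close u l \<and> close v q < close v l" if q: "l < q" "close d q = close d l" for q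
      proof (cases "q < j")
        case True
        have "q \<notin> I" using Max_ge[OF fin, of q] q by (auto simp: l_def)
        then have "close c q < close c l" using True q l by (simp add: I_def)
        then show ?thesis using inv[OF q(1)] by simp
      next
        case False
        have "q < close d j" using q l close_gt[OF hd, of q] by simp
        then have "close u q \<le> close u j" "close v q \<le> close v j"
          using False dle_close[OF du, of j] dle_close[OF dv, of j]
          by (auto intro!: close_nest[OF u] close_nest[OF v])
        then show ?thesis using uv by simp
      qed
      moreover have "close d l < close u l" "close d l < close v l"
        using l(2) uv dle_close[OF du, of j] dle_close[OF dv, of j] by simp_all
      ultimately show False by (intro max[of l])
    qed
    then show ?thesis using le by (simp add: dle_def)
  qed
  then show thesis using that hd du dv by blast
qed

section \<open>Descending steps\<close>

text \<open>A last raise is undone at \<open>v\<close>: an interval of \<open>v\<close> ending at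
  \<open>t\<close> is lowered until its start \<open>f\<close> has height \<open>v t\<close>. Here
  \<open>t\<close> is the first closing position of \<open>v\<close> at which \<open>u\<close>
  closes something earlier.\<close>

lemma dle_descend:
  assumes u: "hpath n u" and v: "hpath n v" and uv: "dle u v" and ne: "u \<noteq> v"
  obtains h k r where "hpath n h" "dle u h" "v = raise h k r" "0 < k" "k < n" "0 < r"
    "h (close h k) = h k" "h k + r \<le> h (k - 1) + 1"
proof -
  have "\<exists>t j. close u j < close v j \<and> close v j = t"
  proof (rule ccontr)
    assume "\<not> ?thesis"
    then have "close v i \<le> close u i" for i by (meson not_le)
    then have "u = v"
      using height_mono_close[OF u v dle_close[OF uv]] height_mono_close[OF v u]
      by (intro ext antisym) auto
    then show False using ne by simp
  qed
  then obtain t where t: "\<exists>j. close u j < close v j \<and> close v j = t"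
    and min: "\<And>s. s < t \<Longrightarrow> \<not> (\<exists>j. close u j < close v j \<and> close v j = s)"
    using exists_least_iff[of "\<lambda>t. \<exists>j. close u j < close v j \<and> close v j = t"] by blast
  then obtain j where j: "close u j < t" "close v j = t" by blast
  have small: "close u l = close v l" if "close v l < t" for l
    using min[OF that] dle_close[OF uv, of l] by force
  \<comment> \<open>Minimality of \<open>t\<close> makes \<open>u\<close> and \<open>v\<close> agree on the positions that \<open>v\<close> closes at \<open>f < t\<close>,
    which is what keeps the lowered path above \<open>u\<close>.\<close>
  define f where "f = (LEAST f. close u f = t \<and> close v f = t)"
  \<comment> \<open>The position just before \<open>t\<close> closes at \<open>t\<close> in both
    sequences, so \<open>f\<close> exists.\<close>
  obtain t' where t': "t = Suc t'" using j by (cases t) auto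
  have "j \<le> t'" using close_gt[OF v, of j] j t' by simp
  then have "close v t' \<le> t" using close_nest[OF v, of j t'] j t' by simp
  then have "close u t' = t \<and> close v t' = t"
    using close_gt[OF u, of t'] dle_close[OF uv, of t'] t' by simp
  then have "close u f = t \<and> close v f = t"
    unfolding f_def by (rule LeastI)
  then have f: "close u f = t" "close v f = t" by auto
  have f_least: "f \<le> l" if "close u l = t" "close v l = t" for l
    unfolding f_def using that by (intro Least_le) auto
  \<comment> \<open>If \<open>f\<close> came before \<open>j\<close>, then \<open>u\<close> would
    nest \<open>j\<close> strictly in \<open>f\<close>, and \<open>v\<close> would inherit this
    although both close at \<open>t\<close> there.\<close>
  have jf: "j < f"
    using dle_inversion[OF uv, of f j] j f by (metis less_irrefl nat_neq_iff)
  have ft: "f < t" using close_gt[OF v, of f] f by simp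
  \<comment> \<open>Lowering by \<open>r\<close> brings \<open>f\<close> to the height of
    \<open>t\<close>, as needed for the raise back to be a dexter edge.\<close>
  define r where "r = v f - v t"
  have "v t \<le> v j" using height_close[OF v, of j] j by simp
  also have "v j < v f" using less_below_close[of j f v] j jf ft by simp
  finally have r: "0 < r" by (simp add: r_def)
  have vt: "0 \<le> v t" using v by (simp add: hpath_def)
  have step: "v (Suc l) \<le> v l + 1" for l using v by (simp add: hpath_def)
  have fn: "f < n" using v r vt unfolding r_def hpath_def by (metis diff_gt_0_iff_gt leD not_le)
  have tn: "t \<le> n" using close_le_n[OF v fn] f by simp
  define h where "h l = (if f \<le> l \<and> l < t then v l - r else v l)" for l
  have low: "v t \<le> v l - r" if "f \<le> l" "l < t" for l
    using le_below_close[OF v that(1)] that f by (simp add: r_def)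
  have hp: "hpath n h"
  proof -
    have "h (Suc l) \<le> h l + 1" for l
    proof (cases "Suc l = f")
      case True
      then show ?thesis using step[of l] r by (auto simp: h_def)
    next
      case False
      show ?thesis
        using step[of l] low[of l] False r by (cases "Suc l = t") (auto simp: h_def)
    qed
    moreover have "0 \<le> h l" for l
      using order_trans[OF vt low[of l]] v by (simp add: h_def hpath_def)
    ultimately show ?thesis
      using v tn jf unfolding hpath_def by (auto simp: h_def)
  qed
  have hf: "close h f = t"
    using ft f less_below_close[of f _ v] by (intro close_eqI) (auto simp: h_def r_def)
  have vraise: "v = raise h f r"
    unfolding raise_def hf by (auto simp: h_def)
  have cv: "close v l = (if close h l = f \<and> h l < h f + r then t else close h l)" for l
    using close_raise[OF hp, of r f l] r vraise hf by simp
  have ch: "close h l = (if close v l = t \<and> l < f then f else close v l)" for l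
  proof (cases "close v l = t \<and> l < f")
    case True
    have "v t \<le> v l" using height_close[OF v, of l] True by simp
    moreover have "h f = v t" "h l = v l" using ft True by (auto simp: h_def r_def)
    ultimately have "close h l \<le> f" using True by (intro close_le) auto
    then show ?thesis using cv[of l] True ft by (auto split: if_splits)
  next
    case False
    then show ?thesis using cv[of l] close_gt[OF hp, of l] by (auto split: if_splits)
  qed
  \<comment> \<open>Otherwise the subpath of \<open>u\<close> at \<open>l\<close> contains
    \<open>f\<close>, so \<open>l\<close> closes at \<open>t\<close> in both sequences, against the
    leastness of \<open>f\<close>.\<close>
  have uP: "close u l \<le> f" if "close v l = t" "l < f" for l
  proof (rule ccontr)
    assume "\<not> close u l \<le> f"
    then have "t \<le> close u l" using close_nest[OF u, of l f] f that by simp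
    then have "close u l = t" using dle_close[OF uv, of l] that by simp
    then show False using f_least[of l] that by simp
  qed
  have "dle u h"
    unfolding dle_def
  proof (intro conjI allI impI)
    show "close u l \<le> close h l" for l
      using uP[of l] dle_close[OF uv, of l] by (auto simp: ch)
  next
    fix p q assume pq: "p < q" "close u q < close u p"
    then have v_pq: "close v q < close v p" by (rule dle_inversion[OF uv])
    show "close h q < close h p"
    proof (cases "close v p = t \<and> p < f")
      case False
      then show ?thesis using v_pq ft by (auto simp: ch)
    next
      case True
      then have "close u p \<le> f" by (intro uP) auto
      then have "close u q < f" using pq by simp
      then have "q < f" using close_gt[OF u, of q] by simp
      \<comment> \<open>In \<open>v\<close>, \<open>q\<close> closes before \<open>t\<close>, where
        \<open>u\<close> and \<open>v\<close> agree by minimality of \<open>t\<close>.\<close>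
      moreover have "close u q = close v q" using True v_pq by (intro small) simp
      ultimately show ?thesis using True \<open>close u q < f\<close> v_pq by (auto simp: ch)
    qed
  qed
  moreover have "h (close h f) = h f" using ft by (simp add: hf) (simp add: h_def r_def)
  moreover have "h f + r \<le> h (f - 1) + 1"
    using step[of "f - 1"] jf ft by (auto simp: h_def)
  ultimately show thesis
    using that[of h f r] hp vraise r fn jf by simp
qed

section \<open>Words and height sequences\<close>

fun ups :: "int \<Rightarrow> letter list \<Rightarrow> int list" where
  "ups y [] = []"
| "ups y (L1 # w) = y # ups (y + 1) w"
| "ups y (L0 # w) = ups (y - 1) w"

lemma height_Cons [simp]: "height (L1 # w) = height w + 1" "height (L0 # w) = height w - 1"
  by (auto simp: height_def)

lemma ups_append: "ups y (u @ v) = ups y u @ ups (y + height u) v"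
  by (induction y u rule: ups.induct) (auto simp: algebra_simps)

lemma ups_replicate [simp]: "ups y (replicate k L0) = []"
  by (induction k arbitrary: y) auto

lemma length_ups: "length (ups y w) = count_list w L1"
  by (induction y w rule: ups.induct) auto

lemma ups_add: "ups (y + r) w = map (\<lambda>x. x + r) (ups y w)"
  by (induction y w rule: ups.induct) (auto simp: algebra_simps)

lemma hd_ups: "ups y w = x # xs \<Longrightarrow> x \<le> y"
  by (induction y w rule: ups.induct) auto

lemma ups_Suc: "Suc k < length (ups y w) \<Longrightarrow> ups y w ! Suc k \<le> ups y w ! k + 1"
proof (induction y w arbitrary: k rule: ups.induct)
  case (2 y w)
  then show ?case
    using hd_ups[of "y + 1" w] by (cases k; cases "ups (y + 1) w") auto
qed auto

lemma ups_nth: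
  "k < length (ups y w) \<Longrightarrow>
    \<exists>u v. w = u @ L1 # v \<and> ups y w ! k = y + height u \<and> length (ups y u) = k"
proof (induction y w arbitrary: k rule: ups.induct)
  case (2 y w)
  show ?case
  proof (cases k)
    case 0
    then show ?thesis by (intro exI[of _ "[]"] exI[of _ w]) auto
  next
    case (Suc m)
    then obtain u v where "w = u @ L1 # v" "ups (y + 1) w ! m = y + 1 + height u"
      "length (ups (y + 1) u) = m"
      using 2(1)[of m] 2(2) by auto
    then show ?thesis using Suc by (intro exI[of _ "L1 # u"] exI[of _ v]) auto
  qed
next
  case (3 y w)
  from 3(2) have "k < length (ups (y - 1) w)" by simp
  from 3(1)[OF this] obtain u v where "w = u @ L1 # v"
    "ups (y - 1) w ! k = y - 1 + height u" "length (ups (y - 1) u) = k" by blast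
  then show ?case by (intro exI[of _ "L0 # u"] exI[of _ v]) auto
qed auto

lemma ups_Nil_height: "ups y w = [] \<Longrightarrow> height w = - int (length w)"
  by (induction y w rule: ups.induct) auto

text \<open>The heights at successive letters 1 give the number of letters 0 between them; only the
  final run of 0 is invisible to \<open>ups\<close>, and the total height fixes it.\<close>

lemma ups_inject: "ups y u = ups y v \<Longrightarrow> height u = height v \<Longrightarrow> u = v"
proof (induction y u arbitrary: v rule: ups.induct)
  case (1 y)
  then show ?case using ups_Nil_height[of y v] by simp
next
  case (2 y w)
  show ?case
  proof (cases v)
    case (Cons c v')
    then show ?thesis using 2 hd_ups[of "y - 1" v' y "ups (y + 1) w"] by (cases c) auto
  qed (use 2 in auto)
next
  case (3 y w)
  show ?case
  proof (cases v)
    case Nil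
    then show ?thesis using 3(2,3) ups_Nil_height[of "y - 1" w] by simp
  next
    case (Cons c v')
    then show ?thesis using 3 hd_ups[of "y - 1" w y "ups (y + 1) v'"] by (cases c) auto
  qed
qed

text \<open>The default 0 is the ground level that \<open>hpath\<close> demands from index
  \<open>n\<close> on.\<close>

definition hts :: "letter list \<Rightarrow> nat \<Rightarrow> int" where
  "hts w = nth_default 0 (ups 0 w)"

lemma hpath_hts:
  assumes "w \<in> dyck_paths n"
  shows "hpath n (hts w)"
proof -
  have pre: "0 \<le> height u" if "prefix u w" for u
    using assms that by (simp add: dyck_paths_iff)
  have len: "length (ups 0 w) = n"
    using assms by (simp add: length_ups dyck_paths_def)
  have nonneg: "0 \<le> hts w k" for k
    using ups_nth[of k 0 w] pre by (auto simp: hts_def nth_default_def)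
  have "hts w 0 \<le> 0"
    by (cases "ups 0 w") (auto simp: hts_def nth_default_def dest: hd_ups)
  moreover have "hts w (Suc k) \<le> hts w k + 1" for k
    using ups_Suc[of k 0 w] nonneg[of k] by (auto simp: hts_def nth_default_def)
  ultimately show ?thesis
    using nonneg len antisym[of "hts w 0" 0]
    by (auto simp: hpath_def) (simp add: hts_def nth_default_def)
qed

lemma hts_inject:
  assumes "v \<in> dyck_paths n" "w \<in> dyck_paths n" "hts v = hts w"
  shows "v = w"
proof -
  have "length (ups 0 v) = n" "length (ups 0 w) = n"
    using assms by (simp_all add: length_ups dyck_paths_def)
  then have "ups 0 v = ups 0 w"
    using assms(3) by (intro nth_equalityI) (auto simp: hts_def nth_default_def fun_eq_iff, metis)
  then show ?thesis using assms by (intro ups_inject) (auto simp: dyck_paths_iff)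
qed

section \<open>From height sequences back to Dyck words\<close>

text \<open>Up-step \<open>k\<close> ends at height \<open>h k + 1\<close>, and the letters 0 lead
  down to the next up-step. For the last block, \<open>h n = 0\<close> produces the final
  descent.\<close>

definition block :: "(nat \<Rightarrow> int) \<Rightarrow> nat \<Rightarrow> letter list" where
  "block h k = L1 # replicate (nat (h k + 1 - h (Suc k))) L0"

definition seg :: "(nat \<Rightarrow> int) \<Rightarrow> nat \<Rightarrow> nat \<Rightarrow> letter list" where
  "seg h i j = concat (map (block h) [i..<j])"

lemma seg_append: "i \<le> j \<Longrightarrow> j \<le> k \<Longrightarrow> seg h i k = seg h i j @ seg h j k"
  unfolding seg_def by (metis concat_append le_add_diff_inverse map_append upt_add_eq_append)

lemma seg_Suc: "i \<le> j \<Longrightarrow> seg h i (Suc j) = seg h i j @ block h j"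
  by (simp add: seg_def)

lemma seg_cong: "(\<And>l. i \<le> l \<Longrightarrow> l < j \<Longrightarrow> block g l = block h l) \<Longrightarrow> seg g i j = seg h i j"
  unfolding seg_def by (intro arg_cong[where f = concat] map_cong) auto

context
  fixes n h
  assumes h: "hpath n h"
begin

lemma height_block: "height (block h k) = h (Suc k) - h k"
  using h by (simp add: block_def hpath_def)

lemma height_seg: "i \<le> j \<Longrightarrow> height (seg h i j) = h j - h i"
  by (induction j rule: dec_induct) (auto simp: seg_Suc height_block, simp add: seg_def)

lemma ups_seg: "i \<le> j \<Longrightarrow> ups (h i) (seg h i j) = map h [i..<j]"
proof (induction j rule: dec_induct)
  case (step j)
  then show ?case by (simp add: seg_Suc ups_append height_seg) (simp add: block_def)
qed (simp add: seg_def)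

text \<open>A nonempty prefix ends in some block \<open>l\<close> after its letter 1, hence no lower
  than \<open>h (Suc l)\<close>, where that block ends. The last clause gives strictness for proper
  prefixes ending in the final block, as the definition of a subpath requires.\<close>

lemma prefix_seg:
  assumes "i \<le> j" "prefix u (seg h i j)" "u \<noteq> []"
  shows "\<exists>l. i \<le> l \<and> l < j \<and> h (Suc l) \<le> h i + height u \<and>
    (Suc l = j \<longrightarrow> u = seg h i j \<or> h j < h i + height u)"
  using assms
proof (induction j rule: dec_induct)
  case (step j)
  consider "prefix u (seg h i j)" | v where "u = seg h i j @ v" "prefix v (block h j)" "v \<noteq> []"
    using step.prems(1) step.hyps unfolding seg_Suc[OF step.hyps(1)] prefix_append by fastforce
  then show ?case
  proof cases
    case 1
    then obtain l where "i \<le> l" "l < j" "h (Suc l) \<le> h i + height u"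
      using step by blast
    then show ?thesis by (intro exI[of _ l]) auto
  next
    case 2
    let ?N = "nat (h j + 1 - h (Suc j))"
    obtain q where q: "q \<le> ?N" "v = L1 # replicate q L0"
      using 2(2,3) unfolding block_def by (cases v) (auto elim: prefix_replicateE)
    have "h i + height u = h j + 1 - int q"
      using 2(1) q step.hyps by (simp add: height_seg)
    moreover have "h (Suc j) \<le> h j + 1" using h by (simp add: hpath_def)
    moreover have "q = ?N \<Longrightarrow> u = seg h i (Suc j)"
      using 2(1) q step.hyps by (simp add: seg_Suc block_def)
    ultimately show ?thesis using q(1) step.hyps by (intro exI[of _ j]) force
  qed
qed (simp add: seg_def)

lemma seg_dyck: "seg h 0 n \<in> dyck_paths n"
proof -
  have z: "h 0 = 0" "h n = 0" using h by (auto simp: hpath_def)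
  have "0 \<le> height u" if pre: "prefix u (seg h 0 n)" for u
  proof (cases "u = []")
    case False
    then obtain l where "h (Suc l) \<le> h 0 + height u" using prefix_seg[OF le0 pre False] by blast
    moreover have "0 \<le> h (Suc l)" using h by (simp add: hpath_def)
    ultimately show ?thesis using z by simp
  qed simp
  moreover have "count_list (seg h 0 n) L1 = n"
    using length_ups[of 0 "seg h 0 n"] ups_seg[of 0 n] z by simp
  moreover have "height (seg h 0 n) = 0" using height_seg[of 0 n] z by simp
  moreover have "count_list w L0 + count_list w L1 = length w" for w
  proof (induction w)
    case (Cons c w)
    then show ?case by (cases c) auto
  qed simp
  ultimately show ?thesis
    unfolding dyck_paths_iff by (metis add_diff_cancel_right' diff_0_right height_def mult_2
        of_nat_eq_iff eq_iff_diff_eq_0)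
qed

lemma hts_seg: "hts (seg h 0 n) = h"
proof
  fix k show "hts (seg h 0 n) k = h k"
    using ups_seg[of 0 n] h by (auto simp: hts_def nth_default_def hpath_def)
qed

text \<open>The raise shortens the run of 0 in block \<open>k - 1\<close> by \<open>r\<close> and
  lengthens the one in block \<open>close h k - 1\<close> by \<open>r\<close>; all other blocks stay
  the same. This moves the subpath between them across \<open>r\<close> letters 0.\<close>

lemma raise_edge:
  assumes k: "0 < k" "k < n" and eq: "h (close h k) = h k"
    and r: "0 < r" "h k + r \<le> h (k - 1) + 1"
  shows "dexter_edge n (seg h 0 n) (seg (raise h k r) 0 n)"
proof -
  let ?e = "close h k" and ?g = "raise h k r"
  have ke: "k < ?e" and en: "?e \<le> n" using close_gt[OF h] close_le_n[OF h k(2)] by auto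
  obtain k' where k': "k = Suc k'" using k by (cases k) auto
  obtain e' where e': "?e = Suc e'" using ke by (cases ?e) auto
  have ke': "k \<le> e'" using ke e' by simp
  define N where "N = nat (h k' + 1 - h k)"
  define i where "i = nat r"
  \<comment> \<open>Ending \<open>a\<close> with the letter 1 of block \<open>k'\<close> makes
    \<open>N\<close> count the whole run of 0 before \<open>x\<close>.\<close>
  define a where "a = seg h 0 k' @ [L1]"
  define x where "x = seg h k ?e"
  define b where "b = seg h ?e n"
  have iN: "1 \<le> i" "i \<le> N" using r k' by (auto simp: i_def N_def)
  have pre: "seg h 0 k = a @ replicate N L0"
    by (simp add: k' a_def N_def seg_Suc) (simp add: block_def)
  have w: "seg h 0 n = a @ replicate N L0 @ x @ b"
    using pre seg_append[of 0 k n h] seg_append[of k ?e n h] ke en k by (simp add: x_def b_def)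
  have g: "?g l = (if k \<le> l \<and> l < Suc e' then h l + r else h l)" for l
    by (simp add: raise_def e')
  have g1: "seg ?g 0 k' = seg h 0 k'"
  proof (rule seg_cong)
    fix l assume "l < k'"
    then have "\<not> k \<le> l" "\<not> k \<le> Suc l" using k' by simp_all
    then show "block ?g l = block h l" by (simp add: block_def g)
  qed
  have g2: "block ?g k' = L1 # replicate (N - i) L0"
  proof -
    have "?g k' = h k'" "?g (Suc k') = h k + r" using k' ke' g[of k'] g[of k] by simp_all
    moreover have "nat (h k' + 1 - (h k + r)) = N - i" using r k' by (simp add: N_def i_def)
    ultimately show ?thesis by (simp add: block_def)
  qed
  have g3: "seg ?g k e' = seg h k e'" by (intro seg_cong) (auto simp: block_def g)
  have g4: "block ?g e' = block h e' @ replicate i L0"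
  proof -
    have "0 \<le> h e' + 1 - h (Suc e')" using h by (simp add: hpath_def)
    then have "nat (h e' + r + 1 - h (Suc e')) = nat (h e' + 1 - h (Suc e')) + i"
      using r by (simp add: i_def nat_add_distrib[symmetric] algebra_simps)
    then show ?thesis using ke' by (simp add: block_def g replicate_add)
  qed
  have "seg ?g 0 k = a @ replicate (N - i) L0"
    using seg_Suc[of 0 k' ?g, folded k'] g1 g2 by (simp add: a_def)
  moreover have "seg ?g k ?e = x @ replicate i L0"
    unfolding x_def e' using g3 g4 ke' by (simp add: seg_Suc)
  moreover have "seg ?g ?e n = b"
    unfolding b_def by (intro seg_cong) (auto simp: block_def g e')
  ultimately have w': "seg ?g 0 n = a @ replicate (N - i) L0 @ x @ replicate i L0 @ b"
    using seg_append[of 0 k n ?g] seg_append[of k ?e n ?g] ke en k by simp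
  have hx: "height x = 0" using height_seg[of k ?e] ke eq by (simp add: x_def)
  have "0 < height u" if u: "strict_prefix u x" "u \<noteq> []" for u
  proof -
    obtain l where l: "k \<le> l" "l < ?e" "h (Suc l) \<le> h k + height u"
      "Suc l = ?e \<longrightarrow> h ?e < h k + height u"
      using prefix_seg[of k ?e u] u ke unfolding x_def strict_prefix_def by (meson less_imp_le)
    show ?thesis
    proof (cases "Suc l = ?e")
      case False
      then have "h k < h (Suc l)" using l by (intro less_below_close) auto
      then show ?thesis using l by simp
    next
      case True
      then show ?thesis using l eq by simp
    qed
  qed
  moreover have "x \<noteq> []" using ke' by (simp add: x_def e' seg_Suc block_def)
  moreover have "b = [] \<or> hd b = L1"
  proof (cases "?e < n")
    case True
    then have "[?e..<n] = ?e # [Suc ?e..<n]" by (rule upt_conv_Cons)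
    then have "b = block h ?e @ seg h (Suc ?e) n" by (simp only: b_def seg_def list.map concat.simps)
    then show ?thesis by (simp add: block_def)
  qed (simp add: b_def seg_def)
  ultimately have "movable (seg h 0 n) (a @ replicate N L0) x b"
    using hx iN unfolding movable_def subpath_def w by simp
  moreover have "last a \<noteq> L0" by (simp add: a_def)
  ultimately show ?thesis
    unfolding dexter_edge_def
    by (intro conjI exI[of _ a] exI[of _ N] exI[of _ x] exI[of _ b] exI[of _ i])
      (use w w' iN seg_dyck in simp_all)
qed

end

section \<open>Dexter edges and reachability in terms of closing positions\<close>

text \<open>Moving \<open>i\<close> letters 0 from before \<open>x\<close> to behind it raises
  exactly the up-steps of \<open>x\<close>, by \<open>i\<close>. As \<open>x\<close> is a movable
  subpath, these form an interval from \<open>k\<close> to its closing position, which has the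
  height of \<open>k\<close>, so \<open>dle_raise\<close> applies.\<close>

lemma edge_dle:
  assumes "dexter_edge n w w'"
  shows "dle (hts w) (hts w')"
proof -
  obtain a N x b i where w: "w \<in> dyck_paths n" "w = a @ replicate N L0 @ x @ b"
    and m: "movable w (a @ replicate N L0) x b" and i: "i \<le> N"
    and w': "w' = a @ replicate (N - i) L0 @ x @ replicate i L0 @ b"
    using assms unfolding dexter_edge_def by blast
  let ?h = "hts w"
  have h: "hpath n ?h" using hpath_hts[OF w(1)] .
  define y where "y = height a - int N"
  define k where "k = length (ups 0 a)"
  define X where "X = ups y x"
  define B where "B = ups y b"
  have hx: "height x = 0" "x \<noteq> []" and xpos: "\<And>u. strict_prefix u x \<Longrightarrow> u \<noteq> [] \<Longrightarrow> 0 < height u"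
    using m by (auto simp: movable_def subpath_def)
  have uw: "ups 0 w = ups 0 a @ X @ B"
    by (simp add: w(2) ups_append X_def B_def y_def hx)
  have uw': "ups 0 w' = ups 0 a @ map (\<lambda>z. z + int i) X @ B"
    using i ups_add[of y "int i" x]
    by (simp add: w' ups_append X_def B_def y_def hx of_nat_diff algebra_simps)
  obtain x' where x': "x = L1 # x'"
  proof (cases x)
    case (Cons c x')
    have "c \<noteq> L0"
    proof
      assume c: "c = L0"
      then have "x' \<noteq> []" using hx Cons by auto
      then have "strict_prefix [L0] x" using Cons c by (simp add: strict_prefix_def)
      from xpos[OF this] show False by simp
    qed
    then show ?thesis using that Cons by (cases c) auto
  qed (use hx in simp)
  have X0: "X \<noteq> []" "X ! 0 = y" by (simp_all add: X_def x')
  have Xl: "y < X ! l" if l: "0 < l" "l < length X" for l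
  proof -
    obtain u v where uv: "x = u @ L1 # v" "X ! l = y + height u" "length (ups y u) = l"
      using ups_nth[of l y x] l unfolding X_def by blast
    have "u \<noteq> []" using uv l by auto
    then show ?thesis using xpos[of u] uv by (simp add: strict_prefix_def)
  qed
  have hk: "?h (k + l) = X ! l" if "l < length X" for l
    using that by (simp add: hts_def nth_default_def uw k_def nth_append)
  \<comment> \<open>Movability enters here: either the next up-step follows \<open>x\<close> at
    once, at height \<open>y\<close>, or \<open>x\<close> ends the path and \<open>y\<close> is the
    default 0.\<close>
  have he: "?h (k + length X) = y"
  proof (cases b)
    case Nil
    have "height w = 0" using w(1) by (simp add: dyck_paths_iff)
    then have "y = 0" by (simp add: w(2) y_def hx Nil)
    then show ?thesis using Nil by (simp add: hts_def nth_default_def uw k_def B_def)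
  next
    case (Cons c b')
    then have "c = L1" using m by (simp add: movable_def)
    then show ?thesis using Cons by (simp add: hts_def nth_default_def uw k_def B_def nth_append)
  qed
  have yk: "?h k = y" using hk[of 0] X0 by simp
  have ck: "close ?h k = k + length X"
  proof (rule close_eqI)
    fix l assume "k < l" "l < k + length X"
    then show "?h k < ?h l" using hk[of "l - k"] Xl[of "l - k"] yk by simp
  qed (use X0 he yk in auto)
  have "hts w' = raise ?h k (int i)"
  proof
    fix l
    show "hts w' l = raise ?h k (int i) l"
      unfolding raise_def ck by (auto simp: hts_def nth_default_def uw uw' k_def nth_append)
  qed
  then show ?thesis using dle_raise[OF h, of "int i" k] ck he yk by simp
qed

text \<open>For the converse, \<open>dle_descend\<close> splits off the last edge into
  \<open>w'\<close>, and its source is again above \<open>w\<close> with smaller area.\<close>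

lemma reachable_iff_dle:
  assumes w: "w \<in> dyck_paths n" "w' \<in> dyck_paths n"
  shows "(dexter_edge n)\<^sup>*\<^sup>* w w' \<longleftrightarrow> dle (hts w) (hts w')"
proof
  assume "(dexter_edge n)\<^sup>*\<^sup>* w w'"
  then show "dle (hts w) (hts w')"
    by induction (auto intro: dle_refl dle_trans edge_dle)
next
  assume "dle (hts w) (hts w')"
  then show "(dexter_edge n)\<^sup>*\<^sup>* w w'"
    using w(2)
  proof (induction "area n (hts w')" arbitrary: w' rule: less_induct)
    case less
    note u = hpath_hts[OF w(1)] and v = hpath_hts[OF less.prems(2)]
    show ?case
    proof (cases "hts w = hts w'")
      case True
      then show ?thesis using hts_inject[OF w(1) less.prems(2)] by simp
    next
      case False
      then obtain h k r where h: "hpath n h" "dle (hts w) h" and r: "hts w' = raise h k r"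
        "0 < k" "k < n" "0 < r" "h (close h k) = h k" "h k + r \<le> h (k - 1) + 1"
        using dle_descend[OF u v less.prems(1)] by blast
      have "area n h < area n (hts w')"
        using r close_gt[OF h(1)] by (intro area_less[OF h(1), where k = k]) (auto simp: raise_def)
      then have "(dexter_edge n)\<^sup>*\<^sup>* w (seg h 0 n)"
        using h seg_dyck[OF h(1)] by (intro less.hyps) (auto simp: hts_seg[OF h(1)])
      moreover have "dexter_edge n (seg h 0 n) (seg (hts w') 0 n)"
        using raise_edge[OF h(1)] r by simp
      moreover have "seg (hts w') 0 n = w'"
        using seg_dyck[OF v] less.prems(2) hts_seg[OF v] by (rule hts_inject)
      ultimately show ?thesis by simp
    qed
  qed
qed

theorem theorem7p6:
  fixes n :: nat
  shows "lower_semilattice (dexter_poset n)"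
proof -
  have carrier: "carrier (dexter_poset n) = dyck_paths n"
    and eq: "eq (dexter_poset n) = (=)"
    and le: "le (dexter_poset n) = (dexter_edge n)\<^sup>*\<^sup>*"
    by (simp_all add: dexter_poset_def)
  interpret partial_order "dexter_poset n"
  proof
    fix x y assume "le (dexter_poset n) x y" "le (dexter_poset n) y x"
      "x \<in> carrier (dexter_poset n)" "y \<in> carrier (dexter_poset n)"
    then show "eq (dexter_poset n) x y"
      using dle_antisym[OF hpath_hts hpath_hts] hts_inject
      by (metis carrier eq le reachable_iff_dle)
  qed (auto simp: carrier eq le)
  show ?thesis
  proof
    fix x y assume "x \<in> carrier (dexter_poset n)" "y \<in> carrier (dexter_poset n)"
    then have x: "x \<in> dyck_paths n" and y: "y \<in> dyck_paths n" by (auto simp: carrier)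
    obtain d where d: "hpath n d" "dle d (hts x)" "dle d (hts y)"
      "\<And>c. hpath n c \<Longrightarrow> dle c (hts x) \<Longrightarrow> dle c (hts y) \<Longrightarrow> dle c d"
      using dle_meet_exists[OF hpath_hts[OF x] hpath_hts[OF y]] by blast
    let ?m = "seg d 0 n"
    have m: "?m \<in> dyck_paths n" "hts ?m = d" using seg_dyck[OF d(1)] hts_seg[OF d(1)] .
    have "greatest (dexter_poset n) ?m (Lower (dexter_poset n) {x, y})"
      unfolding greatest_def Lower_def
      using d m x y by (auto simp: carrier le reachable_iff_dle hpath_hts)
    then show "\<exists>s. greatest (dexter_poset n) s (Lower (dexter_poset n) {x, y})" by blast
  qed
qed

end
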